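(* Let $A$ be a unital complete, completely distributive, atomistic inverse $\wedge$-semigroup, let $T$ be an inverse semigroup and let $\rho\colon T\to A$ be an effective representation. Then $\rho$ is an orthogonal Schein sum of transitive representations in local algebras of $A$, and this is unique up to order of the factors. That is: (Existence) there are a family $(A_i)_{i\in I}$ of non-zero local algebras of $A$ and representations $\psi_i\colon T\to A_i$ $(i\in I)$, each transitive in $A_i$, such that $\otimes\psi_i\colon T\to\prod_{i\in I}A_i$ is an orthogonal Schein sum and $t\rho=\sup\{t\psi_i\colon i\in I\}$ for all $t\in T$; (Uniqueness) if $(A_i)_{i\in I}$, $(\psi_i)_{i\in I}$ and $(B_j)_{j\in J}$, $(\chi_j)_{j\in J}$ are two such decompositions of $\rho$, then there is a bijection $\pi\colon I\to J$ such that $A_i=B_{i\pi}$ and $\psi_i=\chi_{i\pi}$ for all $i\in I$.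
   Context: Maps are written on the right. An inverse $\wedge$-semigroup is an inverse semigroup $A$ in which every two elements have a greatest lower bound $a\wedge b$ in the natural partial order ($a\le b$ iff $a=eb$ for some idempotent $e$). $A$ is complete if every non-empty subset has an infimum in the natural order; then $A$ has a bottom element $0=\inf A$, which is a multiplicative zero, and every subset that is bounded above has a supremum. $A$ is unital if it has an identity element $1_A$. $A$ is atomistic if every element is a supremum of atoms (atoms being the minimal non-zero elements). $A$ is completely distributive if $x(\sup Y)=\sup\{xy\colon y\in Y\}$ for all $x\in A$ and all $Y\subseteq A$ having an upper bound in $A$. $P(A)$ denotes the set of atoms of the idempotent semilattice $E(A)$. A local algebra of $A$ is a subset $eAe$ with $e=e^2\in A$; it is itself a complete atomistic inverse $\wedge$-semigroup with identity $e$. "Subsemigroup" always means inverse subsemigroup. A representation of an inverse semigroup $T$ in $A$ is a semigroup homomorphism $T\to A$. A subsemigroup $S$ of a unital complete atomistic inverse $\wedge$-semigroup $A'$ is (strongly) effective in $A'$ if there is no $p\in P(A')$ with $ps=0$ for all $s\in S$; it is (strongly) transitive in $A'$ if for all $p,q\in P(A')$ there is $s\in S$ with $psq\neq0$. A representation in $A'$ has one of these properties if its image does. For subsemigroups $T_i\le A$ ($i\in I$), $\otimes t_i$ denotes the element $(t_i)_{i\in I}$ of $\prod T_i$; it is bounded if the set $\{t_i\colon i\in I\}$ is bounded above in $A$. The set $\mathscr{B}(\prod T_i)$ of bounded elements is an inverse subsemigroup of $\prod T_i$, and $\omega\colon\mathscr{B}(\prod T_i)\to A$ is the map $(\otimes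 t_i)\omega=\sup\{t_i\colon i\in I\}$ (with $\sup\varnothing=0$). A subsemigroup of $\mathscr{B}(\prod T_i)$ is a Schein sum if the restriction of $\omega$ to it is a homomorphism. Given homomorphisms $\psi_i\colon T\to T_i$, the map $\otimes\psi_i\colon T\to\prod T_i$ is $t\mapsto\otimes(t\psi_i)$; it is called a Schein sum if its image is contained in $\mathscr{B}(\prod T_i)$ and is a Schein sum; the $\psi_i$ are its factors. The Schein sum $\otimes\psi_i$ is orthogonal if $(T\psi_i)(T\psi_j)=\{0\}$ for all $i\neq j$. *)

theory Defs
  imports Main "HOL-Library.FuncSet"
begin

section \<open>Inverse semigroups on carrier sets\<close>

text \<open>
  Semigroups are carrier sets inside a type of class \<open>semigroup_mult\<close>, so that subsemigroups and
  local algebras are simply subsets. Only the notions also needed for the direct product of a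
  family (which is not a type of that class) take the operation as an explicit argument.
\<close>

definition inverse_semigroup_on :: "('a \<Rightarrow> 'a \<Rightarrow> 'a) \<Rightarrow> 'a set \<Rightarrow> bool" where
  "inverse_semigroup_on m S \<longleftrightarrow>
     (\<forall>x\<in>S. \<forall>y\<in>S. m x y \<in> S) \<and>
     (\<forall>x\<in>S. \<forall>y\<in>S. \<forall>z\<in>S. m (m x y) z = m x (m y z)) \<and>
     (\<forall>x\<in>S. \<exists>!y. y \<in> S \<and> m (m x y) x = x \<and> m (m y x) y = y)"

definition semigroup_hom_on ::
    "('a \<Rightarrow> 'a \<Rightarrow> 'a) \<Rightarrow> 'a set \<Rightarrow> ('b \<Rightarrow> 'b \<Rightarrow> 'b) \<Rightarrow> 'b set \<Rightarrow> ('a \<Rightarrow> 'b) \<Rightarrow> bool" where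
  "semigroup_hom_on m S n R f \<longleftrightarrow> f \<in> S \<rightarrow> R \<and> (\<forall>x\<in>S. \<forall>y\<in>S. f (m x y) = n (f x) (f y))"

abbreviation inverse_semigroup :: "'a::semigroup_mult set \<Rightarrow> bool" where
  "inverse_semigroup \<equiv> inverse_semigroup_on (*)"

abbreviation representation ::
    "'t::semigroup_mult set \<Rightarrow> 'a::semigroup_mult set \<Rightarrow> ('t \<Rightarrow> 'a) \<Rightarrow> bool" where
  "representation T A \<equiv> semigroup_hom_on (*) T (*) A"

definition idems :: "'a::semigroup_mult set \<Rightarrow> 'a set" where
  "idems A = {e \<in> A. e * e = e}"

section \<open>The natural partial order\<close>

definition nat_le :: "'a::semigroup_mult set \<Rightarrow> 'a \<Rightarrow> 'a \<Rightarrow> bool" where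
  "nat_le A a b \<longleftrightarrow> (\<exists>e\<in>idems A. a = e * b)"

definition bounded_above :: "'a::semigroup_mult set \<Rightarrow> 'a set \<Rightarrow> bool" where
  "bounded_above A X \<longleftrightarrow> (\<exists>b\<in>A. \<forall>x\<in>X. nat_le A x b)"

definition is_inf :: "'a::semigroup_mult set \<Rightarrow> 'a set \<Rightarrow> 'a \<Rightarrow> bool" where
  "is_inf A X m \<longleftrightarrow> m \<in> A \<and> (\<forall>x\<in>X. nat_le A m x) \<and>
     (\<forall>l\<in>A. (\<forall>x\<in>X. nat_le A l x) \<longrightarrow> nat_le A l m)"

definition is_sup :: "'a::semigroup_mult set \<Rightarrow> 'a set \<Rightarrow> 'a \<Rightarrow> bool" where
  "is_sup A X s \<longleftrightarrow> s \<in> A \<and> (\<forall>x\<in>X. nat_le A x s) \<and>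
     (\<forall>u\<in>A. (\<forall>x\<in>X. nat_le A x u) \<longrightarrow> nat_le A s u)"

text \<open>
  \<open>nat_inf\<close> and \<open>nat_sup\<close> are meaningful only where the infimum or supremum exists. In a complete
  inverse semigroup this covers all non-empty sets and all sets bounded above respectively;
  in particular the supremum of the empty set is the bottom element.
\<close>

definition nat_inf :: "'a::semigroup_mult set \<Rightarrow> 'a set \<Rightarrow> 'a" where
  "nat_inf A X = (THE m. is_inf A X m)"

definition nat_sup :: "'a::semigroup_mult set \<Rightarrow> 'a set \<Rightarrow> 'a" where
  "nat_sup A X = (THE s. is_sup A X s)"

definition bottom :: "'a::semigroup_mult set \<Rightarrow> 'a" where
  "bottom A = nat_inf A A"

definition nat_atoms :: "'a::semigroup_mult set \<Rightarrow> 'a set" where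
  "nat_atoms A = {a \<in> A. a \<noteq> bottom A \<and> (\<forall>b\<in>A. nat_le A b a \<longrightarrow> b = bottom A \<or> b = a)}"

text \<open>
  The set \<open>P(A)\<close>. The semilattice \<open>E(A)\<close> is itself an inverse semigroup all of whose elements are
  idempotent, and its natural order is the semilattice order.
\<close>

definition idem_atoms :: "'a::semigroup_mult set \<Rightarrow> 'a set" where
  "idem_atoms A = nat_atoms (idems A)"

definition inverse_meet_semigroup :: "'a::semigroup_mult set \<Rightarrow> bool" where
  "inverse_meet_semigroup A \<longleftrightarrow>
     inverse_semigroup A \<and> (\<forall>a\<in>A. \<forall>b\<in>A. \<exists>m. is_inf A {a, b} m)"

definition unital :: "'a::semigroup_mult set \<Rightarrow> bool" where
  "unital A \<longleftrightarrow> (\<exists>u\<in>A. \<forall>a\<in>A. u * a = a \<and> a * u = a)"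

definition nat_complete :: "'a::semigroup_mult set \<Rightarrow> bool" where
  "nat_complete A \<longleftrightarrow> (\<forall>X. X \<subseteq> A \<longrightarrow> X \<noteq> {} \<longrightarrow> (\<exists>m. is_inf A X m))"

definition completely_distributive :: "'a::semigroup_mult set \<Rightarrow> bool" where
  "completely_distributive A \<longleftrightarrow>
     (\<forall>x\<in>A. \<forall>Y. Y \<subseteq> A \<longrightarrow> bounded_above A Y \<longrightarrow> x * nat_sup A Y = nat_sup A {x * y | y. y \<in> Y})"

definition atomistic :: "'a::semigroup_mult set \<Rightarrow> bool" where
  "atomistic A \<longleftrightarrow> (\<forall>a\<in>A. \<exists>Y. Y \<subseteq> nat_atoms A \<and> is_sup A Y a)"

definition local_algebra :: "'a::semigroup_mult set \<Rightarrow> 'a set \<Rightarrow> bool" where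
  "local_algebra A B \<longleftrightarrow> (\<exists>e\<in>idems A. B = {e * a * e | a. a \<in> A})"

section \<open>Effective and transitive subsemigroups\<close>

definition effective_in :: "'a::semigroup_mult set \<Rightarrow> 'a set \<Rightarrow> bool" where
  "effective_in A S \<longleftrightarrow> \<not> (\<exists>p\<in>idem_atoms A. \<forall>s\<in>S. p * s = bottom A)"

definition transitive_in :: "'a::semigroup_mult set \<Rightarrow> 'a set \<Rightarrow> bool" where
  "transitive_in A S \<longleftrightarrow> (\<forall>p\<in>idem_atoms A. \<forall>q\<in>idem_atoms A. \<exists>s\<in>S. p * s * q \<noteq> bottom A)"

section \<open>Schein sums\<close>

text \<open>
  The product \<open>\<Prod>T\<^sub>i\<close> is \<open>PiE I S\<close> (functions that are \<open>undefined\<close> outside \<open>I\<close>), with the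
  componentwise operation \<open>prod_mult I\<close>. Boundedness and suprema are taken in \<open>A\<close>.
\<close>

definition prod_mult :: "'i set \<Rightarrow> ('i \<Rightarrow> 'a::semigroup_mult) \<Rightarrow> ('i \<Rightarrow> 'a) \<Rightarrow> ('i \<Rightarrow> 'a)" where
  "prod_mult I t u = (\<lambda>i\<in>I. t i * u i)"

definition bounded_prod :: "'a::semigroup_mult set \<Rightarrow> 'i set \<Rightarrow> ('i \<Rightarrow> 'a set) \<Rightarrow> ('i \<Rightarrow> 'a) set" where
  "bounded_prod A I S = {t \<in> PiE I S. bounded_above A (t ` I)}"

definition omega :: "'a::semigroup_mult set \<Rightarrow> 'i set \<Rightarrow> ('i \<Rightarrow> 'a) \<Rightarrow> 'a" where
  "omega A I t = nat_sup A (t ` I)"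

definition schein_sum_set ::
    "'a::semigroup_mult set \<Rightarrow> 'i set \<Rightarrow> ('i \<Rightarrow> 'a set) \<Rightarrow> ('i \<Rightarrow> 'a) set \<Rightarrow> bool" where
  "schein_sum_set A I S R \<longleftrightarrow>
     R \<subseteq> bounded_prod A I S \<and> inverse_semigroup_on (prod_mult I) R \<and>
     semigroup_hom_on (prod_mult I) R (*) A (omega A I)"

definition tensor :: "'i set \<Rightarrow> ('i \<Rightarrow> 't \<Rightarrow> 'a) \<Rightarrow> 't \<Rightarrow> ('i \<Rightarrow> 'a)" where
  "tensor I \<psi> t = (\<lambda>i\<in>I. \<psi> i t)"

definition schein_sum ::
    "'a::semigroup_mult set \<Rightarrow> 't::semigroup_mult set \<Rightarrow> 'i set \<Rightarrow> ('i \<Rightarrow> 'a set) \<Rightarrow>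
     ('i \<Rightarrow> 't \<Rightarrow> 'a) \<Rightarrow> bool" where
  "schein_sum A T I S \<psi> \<longleftrightarrow>
     (\<forall>i\<in>I. S i \<subseteq> A \<and> inverse_semigroup (S i) \<and> representation T (S i) (\<psi> i)) \<and>
     schein_sum_set A I S (tensor I \<psi> ` T)"

definition orthogonal_sum ::
    "'a::semigroup_mult set \<Rightarrow> 't set \<Rightarrow> 'i set \<Rightarrow> ('i \<Rightarrow> 't \<Rightarrow> 'a) \<Rightarrow> bool" where
  "orthogonal_sum A T I \<psi> \<longleftrightarrow>
     (\<forall>i\<in>I. \<forall>j\<in>I. i \<noteq> j \<longrightarrow> {x * y | x y. x \<in> \<psi> i ` T \<and> y \<in> \<psi> j ` T} = {bottom A})"

definition transitive_decomposition ::
    "'a::semigroup_mult set \<Rightarrow> 't::semigroup_mult set \<Rightarrow> ('t \<Rightarrow> 'a) \<Rightarrow>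
     'i set \<Rightarrow> ('i \<Rightarrow> 'a set) \<Rightarrow> ('i \<Rightarrow> 't \<Rightarrow> 'a) \<Rightarrow> bool" where
  "transitive_decomposition A T \<rho> I B \<psi> \<longleftrightarrow>
     (\<forall>i\<in>I. local_algebra A (B i) \<and> B i \<noteq> {bottom A} \<and>
            representation T (B i) (\<psi> i) \<and> transitive_in (B i) (\<psi> i ` T)) \<and>
     schein_sum A T I B \<psi> \<and> orthogonal_sum A T I \<psi> \<and>
     (\<forall>t\<in>T. \<rho> t = nat_sup A {\<psi> i t | i. i \<in> I})"

end

theory Submission
  imports Defs
begin

text \<open>
  The atoms of \<open>E(A)\<close> play the part of points: an element of \<open>A\<close> is determined by its products
  with the atoms on the left (\<open>eq_if_atoms_eq\<close>), and it moves atoms like a partial bijection. The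
  latter is the content of \<open>atom_mult_absorb\<close>: if \<open>p\<close> is an atom and \<open>q\<close> an idempotent with \<open>p * s * q\<close>
  non-zero, then already \<open>p * s * q = p * s\<close>, because \<open>p * s\<close> has the single target point that
  lies below \<open>q\<close>. Call \<open>p\<close> and \<open>q\<close> linked if \<open>p * \<rho> t * q\<close> is non-zero for some \<open>t\<close>. Paths of
  atoms can be composed, so this relation is transitive; inverses in \<open>T\<close> make it symmetric, and
  effectiveness makes it reflexive. Its classes are the orbits of \<open>T\<close> on the points.

  For existence, let \<open>e\<close> be the supremum of an orbit. By complete distributivity the atoms below \<open>e\<close>
  are exactly the members of the orbit. Points of the orbit are never moved out of it, hence
  \<open>e * \<rho> t * e = e * \<rho> t\<close>. Therefore \<open>t \<mapsto> e * \<rho> t\<close> is multiplicative with values in \<open>eAe\<close>, and it is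
  transitive there because its points form one orbit. Distinct orbits have orthogonal suprema, and
  every atom lies in an orbit, so these representations add up orthogonally to \<open>\<rho>\<close>.

  For uniqueness, let \<open>e i\<close> be the identities of the local algebras of any decomposition. An atom
  below both \<open>e i\<close> and \<open>e j\<close> is a point that by transitivity can be returned to itself first by \<open>\<psi> i\<close>
  and then by \<open>\<psi> j\<close>, against orthogonality. So the \<open>e i\<close> are orthogonal, and multiplying the
  supremum \<open>\<rho> t\<close> by \<open>e i\<close> leaves \<open>\<psi> i t\<close>. Effectiveness places each atom below some \<open>e i\<close>, and
  transitivity shows that the atoms below \<open>e i\<close> form one orbit (\<open>decomposition_units\<close>). Thus \<open>\<rho>\<close>
  alone determines the set of the \<open>e i\<close>, and with it the local algebras and the factors.
\<close>

section \<open>Inverses and the natural order\<close>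

locale inv_semigroup =
  fixes A :: "'a::semigroup_mult set"
  assumes inverse_semigroup: "inverse_semigroup A"
begin

abbreviation E :: "'a set" where "E \<equiv> idems A"

abbreviation le :: "'a \<Rightarrow> 'a \<Rightarrow> bool" (infix "\<preceq>" 50) where "a \<preceq> b \<equiv> nat_le A a b"

definition star :: "'a \<Rightarrow> 'a" where
  "star x = (THE y. y \<in> A \<and> x * y * x = x \<and> y * x * y = y)"

lemma mult_closed [simp, intro]: "x \<in> A \<Longrightarrow> y \<in> A \<Longrightarrow> x * y \<in> A"
  using inverse_semigroup unfolding inverse_semigroup_on_def by blast

lemma ex1_inverse: "x \<in> A \<Longrightarrow> \<exists>!y. y \<in> A \<and> x * y * x = x \<and> y * x * y = y"
  using inverse_semigroup unfolding inverse_semigroup_on_def by (elim conjE) (erule bspec)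

lemma star:
  assumes "x \<in> A"
  shows star_closed [simp, intro]: "star x \<in> A"
    and mult_star_mult: "x * star x * x = x"
    and star_mult_star: "star x * x * star x = star x"
  using theI'[OF ex1_inverse[OF assms], folded star_def] by simp_all

lemma inverse_unique:
  assumes "x \<in> A" "y \<in> A" "x * y * x = x" "y * x * y = y"
    and "z \<in> A" "x * z * x = x" "z * x * z = z"
  shows "y = z"
  using ex1_inverse[OF assms(1)] assms by blast

lemma idemsI: "e \<in> A \<Longrightarrow> e * e = e \<Longrightarrow> e \<in> E"
  by (simp add: idems_def)

lemma idems_closed [simp, intro]: "e \<in> E \<Longrightarrow> e \<in> A"
  by (simp add: idems_def)

lemma idems_idem: "e \<in> E \<Longrightarrow> e * e = e"
  unfolding idems_def by (elim CollectE conjE)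

lemma idems_idem_left: "e \<in> E \<Longrightarrow> e * (e * x) = e * x"
  by (metis idems_idem mult.assoc)

text \<open>
  With \<open>x\<close> the inverse of \<open>e * f\<close>, the element \<open>f * x * e\<close> is an inverse of \<open>e * f\<close> as well, so it
  equals \<open>x\<close>. In this form \<open>x\<close> is visibly idempotent, hence its own inverse, which is \<open>e * f\<close>.
\<close>

lemma mult_idems_idem:
  assumes e: "e \<in> E" and f: "f \<in> E"
  shows "e * f \<in> E"
proof -
  define x where "x = star (e * f)"
  have xA: "x \<in> A" using e f by (simp add: x_def)
  have x1: "e * f * x * (e * f) = e * f" and x2: "x * (e * f) * x = x"
    using e f mult_star_mult star_mult_star by (auto simp: x_def)
  have x1': "e * (f * (x * (e * f))) = e * f" using x1 by (simp add: mult.assoc)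
  have x2': "x * (e * (f * x)) = x" using x2 by (simp add: mult.assoc)
  have "x = f * x * e"
  proof (rule inverse_unique[of "e * f"])
    show "e * f * (f * x * e) * (e * f) = e * f"
      using x1' by (simp add: mult.assoc idems_idem_left[OF e] idems_idem_left[OF f])
    have "f * (x * (e * (f * (x * e)))) = f * (x * e)"
      using x2' by (metis mult.assoc)
    then show "f * x * e * (e * f) * (f * x * e) = f * x * e"
      by (simp add: mult.assoc idems_idem_left[OF e] idems_idem_left[OF f])
  qed (use e f xA x1 x2 in auto)
  then have xx: "x * x = x"
    by (metis mult.assoc x2')
  have "e * f = x"
  proof (rule inverse_unique[of x])
    show "x * (e * f) * x = x" "e * f * x * (e * f) = e * f" by fact+
  qed (use e f xA xx in auto)
  then show ?thesis using xx xA by (simp add: idemsI)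
qed

text \<open>
  Both products are idempotent, so \<open>e * f\<close> is its own inverse; but \<open>f * e\<close> is an inverse of it
  as well.
\<close>

lemma idems_commute:
  assumes e: "e \<in> E" and f: "f \<in> E"
  shows "e * f = f * e"
proof (rule inverse_unique[of "e * f"])
  have i: "e * f * (e * f) = e * f" "f * e * (f * e) = f * e"
    using mult_idems_idem[OF e f] mult_idems_idem[OF f e] by (simp_all add: idems_idem)
  then show "e * f * (e * f) * (e * f) = e * f" by simp
  then show "e * f * (e * f) * (e * f) = e * f" .
  show "e * f * (f * e) * (e * f) = e * f" "f * e * (e * f) * (f * e) = f * e"
    using i by (simp_all add: mult.assoc idems_idem_left[OF e] idems_idem_left[OF f])
qed (use e f in auto)

lemma mult_star_idem [simp, intro]: "x \<in> A \<Longrightarrow> x * star x \<in> E"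
  by (intro idemsI) (auto simp flip: mult.assoc simp: mult_star_mult)

lemma star_mult_idem [simp, intro]: "x \<in> A \<Longrightarrow> star x * x \<in> E"
  by (intro idemsI) (auto simp flip: mult.assoc simp: star_mult_star)

lemma conj_idem:
  assumes e: "e \<in> E" and x: "x \<in> A"
  shows "x * e * star x \<in> E"
proof (rule idemsI)
  have "x * e * star x * (x * e * star x) = x * (e * (star x * x)) * e * star x"
    by (simp add: mult.assoc)
  also have "\<dots> = x * star x * x * (e * e) * star x"
    using idems_commute[OF e star_mult_idem[OF x]] by (simp add: mult.assoc)
  finally show "x * e * star x * (x * e * star x) = x * e * star x"
    using x e by (simp add: mult_star_mult idems_idem)
qed (use e x in auto)

lemma le_refl: "a \<in> A \<Longrightarrow> a \<preceq> a"
  unfolding nat_le_def by (metis mult_star_idem mult_star_mult)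

lemma mult_idem_le: "e \<in> E \<Longrightarrow> e * a \<preceq> a"
  unfolding nat_le_def by blast

lemma le_trans: "a \<preceq> b \<Longrightarrow> b \<preceq> c \<Longrightarrow> a \<preceq> c"
  unfolding nat_le_def by (metis mult.assoc mult_idems_idem)

lemma le_antisym: "a \<preceq> b \<Longrightarrow> b \<preceq> a \<Longrightarrow> a = b"
  unfolding nat_le_def by (metis mult.assoc idems_commute idems_idem)

lemma is_sup_unique: "is_sup A X s \<Longrightarrow> nat_sup A X = s"
  unfolding nat_sup_def is_sup_def by (rule the_equality) (auto intro: le_antisym)

end

section \<open>Complete atomistic inverse semigroups\<close>

locale atomistic_inv_semigroup = inv_semigroup +
  assumes unital: "unital A"
    and complete: "nat_complete A"
    and distributive: "completely_distributive A"
    and atomistic: "atomistic A"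
begin

abbreviation zero :: 'a (\<open>\<zero>\<close>) where "\<zero> \<equiv> bottom A"

abbreviation P :: "'a set" where "P \<equiv> idem_atoms A"

lemma zero_is_inf: "is_inf A A \<zero>"
proof -
  have "A \<noteq> {}" using unital by (auto simp: unital_def)
  then obtain m where m: "is_inf A A m" using complete by (auto simp: nat_complete_def)
  then have "nat_inf A A = m"
    unfolding nat_inf_def is_inf_def by (intro the_equality) (auto intro: le_antisym)
  then show ?thesis using m by (simp add: bottom_def)
qed

lemma zero_closed [simp, intro]: "\<zero> \<in> A" and zero_le: "x \<in> A \<Longrightarrow> \<zero> \<preceq> x"
  using zero_is_inf by (auto simp: is_inf_def)

lemma bounded_is_sup:
  assumes "X \<subseteq> A" "bounded_above A X"
  shows "is_sup A X (nat_sup A X)"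
proof -
  let ?U = "{u \<in> A. \<forall>x\<in>X. x \<preceq> u}"
  have "?U \<noteq> {}" using assms(2) by (auto simp: bounded_above_def)
  then obtain m where "is_inf A ?U m"
    using complete unfolding nat_complete_def by (metis (no_types, lifting) mem_Collect_eq subsetI)
  then have "is_sup A X m"
    using assms(1) by (auto simp: is_inf_def is_sup_def)
  then show ?thesis by (simp add: is_sup_unique)
qed

text \<open>
  The bottom element is the supremum of the empty set, so distributivity makes it a right zero of
  every element. That it is a zero on the other side as well follows from uniqueness of inverses.
\<close>

lemma mult_zero [simp]:
  assumes "x \<in> A" shows "x * \<zero> = \<zero>"
proof -
  have b: "bounded_above A {}" by (auto simp: bounded_above_def)
  have "is_sup A {} \<zero>" by (auto simp: is_sup_def zero_le)
  then have "nat_sup A {} = \<zero>" by (rule is_sup_unique)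
  moreover have "x * nat_sup A {} = nat_sup A {x * y | y. y \<in> {}}"
    using distributive assms b unfolding completely_distributive_def by blast
  ultimately show ?thesis by simp
qed

lemma zero_mult [simp]:
  assumes "x \<in> A" shows "\<zero> * x = \<zero>"
proof (rule inverse_unique[of \<zero>])
  have *: "\<zero> * x * \<zero> = \<zero>" using assms by simp
  then show "\<zero> * (\<zero> * x) * \<zero> = \<zero>" "\<zero> * x * \<zero> * (\<zero> * x) = \<zero> * x"
    by (simp_all flip: mult.assoc)
qed (use assms in auto)

lemma zero_idem [simp, intro]: "\<zero> \<in> E"
  by (simp add: idemsI)

text \<open>
  Order, bottom and atoms are relative to a carrier \<open>S\<close>, which may be \<open>A\<close>, a local algebra or the
  set of idempotents of either. They are brought back here to the zero and the products of \<open>A\<close>.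
\<close>

lemma bottom_subset:
  assumes "S \<subseteq> A" "\<zero> \<in> S"
  shows "bottom S = \<zero>"
proof -
  have z: "\<zero> \<in> idems S" using assms by (simp add: idems_def)
  have "\<zero> = \<zero> * x" if "x \<in> S" for x using assms that by (simp add: subset_iff)
  then have le: "nat_le S \<zero> x" if "x \<in> S" for x
    unfolding nat_le_def using z that by blast
  have "m = \<zero>" if "nat_le S m \<zero>" for m
    using that assms unfolding nat_le_def idems_def by (metis (no_types, lifting) mem_Collect_eq mult_zero subsetD)
  then have "nat_inf S S = \<zero>"
    unfolding nat_inf_def is_inf_def using le assms(2) by (intro the_equality) auto
  then show ?thesis by (simp only: bottom_def[of S])
qed

text \<open>
  The elements of \<open>idems S\<close> below \<open>p\<close> are those products \<open>f * p\<close> that lie in \<open>idems S\<close>; the premise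
  on \<open>f * p\<close> stands for closure of \<open>idems S\<close> under multiplication.
\<close>

lemma idem_atoms_iff:
  assumes "S \<subseteq> A" "\<zero> \<in> S"
  shows "p \<in> idem_atoms S \<longleftrightarrow>
    p \<in> idems S \<and> p \<noteq> \<zero> \<and> (\<forall>f\<in>idems S. f * p \<in> idems S \<longrightarrow> f * p = \<zero> \<or> f * p = p)"
proof -
  have "bottom (idems S) = \<zero>"
    using assms by (intro bottom_subset) (auto simp: idems_def)
  moreover have "idems (idems S) = idems S" by (auto simp: idems_def)
  ultimately show ?thesis
    unfolding idem_atoms_def nat_atoms_def nat_le_def by auto
qed

lemma P_iff: "p \<in> P \<longleftrightarrow> p \<in> E \<and> p \<noteq> \<zero> \<and> (\<forall>f\<in>E. f * p = \<zero> \<or> f * p = p)"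
  using idem_atoms_iff[of A p] mult_idems_idem by auto

lemma P_idem [simp, intro]: "p \<in> P \<Longrightarrow> p \<in> E"
  and P_nonzero: "p \<in> P \<Longrightarrow> p \<noteq> \<zero>"
  and P_cases: "p \<in> P \<Longrightarrow> f \<in> E \<Longrightarrow> p * f = \<zero> \<or> p * f = p"
  by (auto simp: P_iff idems_commute)

lemma P_closed [simp, intro]: "p \<in> P \<Longrightarrow> p \<in> A"
  by auto

lemma P_mult_eq: "p \<in> P \<Longrightarrow> q \<in> P \<Longrightarrow> p * q \<noteq> \<zero> \<Longrightarrow> p = q"
  by (metis P_cases P_idem idems_commute)

text \<open>
  An idempotent \<open>f\<close> turns the atom \<open>a\<close> into zero or into itself, hence does the same to its domain.
\<close>

lemma atom_domain:
  assumes a: "a \<in> nat_atoms A"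
  shows "a * star a \<in> P"
  unfolding P_iff
proof (intro conjI ballI)
  have aA: "a \<in> A" "a \<noteq> \<zero>" using a by (auto simp: nat_atoms_def)
  then show "a * star a \<in> E" "a * star a \<noteq> \<zero>"
    using mult_star_mult[of a] by auto
  fix f assume f: "f \<in> E"
  have "f * a = \<zero> \<or> f * a = a"
    using a f aA mult_idem_le[OF f, of a] by (auto simp: nat_atoms_def)
  then show "f * (a * star a) = \<zero> \<or> f * (a * star a) = a * star a"
    using aA by (auto simp flip: mult.assoc)
qed

text \<open>
  Each atom \<open>y\<close> of \<open>A\<close> below \<open>a\<close> has the form \<open>p * a\<close> with \<open>p = y * star y\<close> an atom of \<open>E(A)\<close>, and
  \<open>a\<close> is the supremum of some such \<open>y\<close>.
\<close>

lemma le_if_atoms_le: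
  assumes a: "a \<in> A" and u: "u \<in> A" and le: "\<And>p. p \<in> P \<Longrightarrow> p * a \<preceq> u"
  shows "a \<preceq> u"
proof -
  obtain Y where Y: "Y \<subseteq> nat_atoms A" "is_sup A Y a"
    using atomistic a by (auto simp: atomistic_def)
  have "y \<preceq> u" if y: "y \<in> Y" for y
  proof -
    obtain f where f: "f \<in> E" "y = f * a"
      using Y y by (auto simp: is_sup_def nat_le_def)
    have yA: "y \<in> A" using a f by simp
    have "y * star y * a = y"
    proof -
      have "f * y = y" using f by (simp add: idems_idem_left)
      then have "y * star y * f = y * star y"
        using idems_commute[OF f(1) mult_star_idem[OF yA]] by (metis mult.assoc)
      then have "y * star y * a = y * star y * y" using f(2) by (metis mult.assoc)
      then show ?thesis using yA by (simp add: mult_star_mult)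
    qed
    then show ?thesis using le[OF atom_domain[of y]] Y y by auto
  qed
  then show ?thesis using Y u by (auto simp: is_sup_def)
qed

lemma eq_if_atoms_eq:
  assumes "a \<in> A" "b \<in> A" and eq: "\<And>p. p \<in> P \<Longrightarrow> p * a = p * b"
  shows "a = b"
proof (rule le_antisym)
  show "a \<preceq> b" by (rule le_if_atoms_le) (use assms in \<open>auto simp: mult_idem_le\<close>)
  show "b \<preceq> a" by (rule le_if_atoms_le) (use assms in \<open>auto simp: mult_idem_le simp flip: eq\<close>)
qed

lemma ex_atom_mult_nonzero:
  assumes "a \<in> A" "a \<noteq> \<zero>"
  shows "\<exists>p\<in>P. p * a \<noteq> \<zero>"
  using eq_if_atoms_eq[of a \<zero>] assms by force

lemma idems_eq_if_atoms_eq: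
  assumes "e \<in> E" "f \<in> E" and "\<And>p. p \<in> P \<Longrightarrow> p * e = p \<longleftrightarrow> p * f = p"
  shows "e = f"
  using eq_if_atoms_eq[of e f] P_cases assms by (metis idems_closed)

text \<open>
  The idempotent \<open>s * q * star s\<close> is the preimage of \<open>q\<close> under \<open>s\<close>; it meets the atom \<open>p\<close>, so it
  lies above it, that is, \<open>s\<close> carries all of \<open>p\<close> into \<open>q\<close>.
\<close>

lemma atom_mult_absorb:
  assumes p: "p \<in> P" and s: "s \<in> A" and q: "q \<in> E" and nz: "p * s * q \<noteq> \<zero>"
  shows "p * s * q = p * s"
proof -
  have d: "s * q * star s \<in> E" using conj_idem q s by simp
  have comm: "q * (star s * s) = star s * s * q" using idems_commute q s by auto
  have restore: "p * (s * q * star s) * s = p * s * q"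
    using comm s by (metis mult.assoc mult_star_mult)
  then have "p * (s * q * star s) \<noteq> \<zero>" using nz s by auto
  then have "p * (s * q * star s) = p" using P_cases[OF p d] by simp
  then show ?thesis using restore by simp
qed

text \<open>The mirror image, with the image \<open>star s * p * s\<close> in place of the preimage.\<close>

lemma atom_mult_absorb_left:
  assumes p: "p \<in> E" and s: "s \<in> A" and q: "q \<in> P" and nz: "p * s * q \<noteq> \<zero>"
  shows "p * s * q = s * q"
proof -
  have d: "star s * p * s \<in> E"
  proof (rule idemsI)
    have "star s * p * s * (star s * p * s) = star s * (p * (s * star s)) * p * s"
      by (simp add: mult.assoc)
    also have "\<dots> = star s * s * star s * (p * p) * s"
      using idems_commute[OF p mult_star_idem[OF s]] by (simp add: mult.assoc)
    finally show "star s * p * s * (star s * p * s) = star s * p * s"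
      using p s by (simp add: star_mult_star idems_idem)
  qed (use p s in auto)
  have comm: "s * star s * p = p * (s * star s)" using idems_commute p s by auto
  have restore: "s * (star s * p * s * q) = p * s * q"
    using comm s by (metis mult.assoc mult_star_mult)
  then have "star s * p * s * q \<noteq> \<zero>" using nz s by auto
  then have "star s * p * s * q = q" using P_cases[OF q d] idems_commute q d by auto
  then show ?thesis using restore by simp
qed

text \<open>
  If the composite vanished, so would \<open>s * q * t * r\<close>. But \<open>q\<close> lies below the range \<open>star s * s\<close>, so
  \<open>star s\<close> recovers \<open>q * t * r\<close> from it.
\<close>

lemma atom_paths_compose:
  assumes "p \<in> P" "q \<in> P" "r \<in> P" "s \<in> A" "t \<in> A"
    and psq: "p * s * q \<noteq> \<zero>" and qtr: "q * t * r \<noteq> \<zero>"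
  shows "p * (s * t) * r \<noteq> \<zero>"
proof
  assume "p * (s * t) * r = \<zero>"
  then have z: "p * s * q * (t * r) = \<zero>"
    using atom_mult_absorb[of p s q] assms by (simp add: mult.assoc)
  have sq: "p * s * q = s * q" using atom_mult_absorb_left assms by auto
  have "star s * (s * q) = q"
    using P_cases[of q "star s * s"] idems_commute[of q "star s * s"] assms sq
    by (metis P_idem mult.assoc mult_star_mult mult_zero star_mult_idem mult_closed P_closed)
  then have "q * t * r = star s * (p * s * q * (t * r))" using sq by (metis mult.assoc)
  then show False using z qtr assms by simp
qed

lemma atom_mult_ex_target:
  assumes p: "p \<in> P" and t: "t \<in> A" and nz: "p * t \<noteq> \<zero>"
  shows "\<exists>q\<in>P. p * t * q \<noteq> \<zero>"
proof -
  let ?x = "star (p * t) * (p * t)"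
  have xA: "?x \<in> E" "p * t \<in> A" using p t by auto
  have "?x \<noteq> \<zero>" using mult_star_mult[OF xA(2)] nz xA by (metis mult.assoc mult_zero)
  then obtain q where q: "q \<in> P" "q * ?x \<noteq> \<zero>" using ex_atom_mult_nonzero xA by blast
  then have "?x * q \<noteq> \<zero>" using idems_commute xA by auto
  then have "p * t * q \<noteq> \<zero>" using xA by (metis mult.assoc mult_zero star_closed)
  then show ?thesis using q by blast
qed

text \<open>
  This is the form in which complete distributivity acts on orthogonal families: \<open>x\<close> is an atom or
  the identity of a local algebra, which keeps one term of the supremum and annihilates the others.
\<close>

lemma mult_nat_sup:
  assumes "x \<in> A" "Y \<subseteq> A" "bounded_above A Y" "y \<in> Y"
    and vanish: "\<And>z. z \<in> Y \<Longrightarrow> x * z = x * y \<or> x * z = \<zero>"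
  shows "x * nat_sup A Y = x * y"
proof -
  have "is_sup A {x * z | z. z \<in> Y} (x * y)"
    unfolding is_sup_def
  proof (intro conjI ballI impI)
    fix w assume "w \<in> {x * z | z. z \<in> Y}"
    then have "w = x * y \<or> w = \<zero>" using vanish by blast
    then show "w \<preceq> x * y" using assms by (auto intro: le_refl zero_le)
  qed (use assms in auto)
  then have "nat_sup A {x * z | z. z \<in> Y} = x * y" by (rule is_sup_unique)
  then show ?thesis
    using distributive assms(1-3) unfolding completely_distributive_def by simp
qed

lemma idems_bounded:
  assumes "X \<subseteq> E"
  shows "bounded_above A X" and "nat_sup A X \<in> E"
proof -
  obtain u where u: "u \<in> A" "\<And>a. a \<in> A \<Longrightarrow> u * a = a \<and> a * u = a"
    using unital by (auto simp: unital_def)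
  have le: "\<forall>x\<in>X. x \<preceq> u"
    using assms u unfolding nat_le_def by (metis idems_closed subsetD)
  then show b: "bounded_above A X" using u by (auto simp: bounded_above_def)
  then have "nat_sup A X \<preceq> u"
    using bounded_is_sup[of X] assms u le by (auto simp: is_sup_def)
  then show "nat_sup A X \<in> E" using u by (auto simp: nat_le_def)
qed

lemma atom_mult_nat_sup:
  assumes X: "X \<subseteq> P" "X \<noteq> {}" and p: "p \<in> P"
  shows "p * nat_sup A X = (if p \<in> X then p else \<zero>)"
proof -
  have b: "bounded_above A X" "X \<subseteq> A" using X idems_bounded[of X] by auto
  have off: "p * z = \<zero>" if "z \<in> X" "z \<noteq> p" for z
    using P_mult_eq[of p z] that X p by auto
  show ?thesis
  proof (cases "p \<in> X")
    case True
    then have "p * nat_sup A X = p * p"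
      using mult_nat_sup[of p X p] b p off by auto
    then show ?thesis using True p by (simp add: idems_idem)
  next
    case False
    obtain x where "x \<in> X" using X by blast
    then have "p * nat_sup A X = p * x"
      using mult_nat_sup[of p X x] b p off False by auto
    then show ?thesis using off False \<open>x \<in> X\<close> by auto
  qed
qed

section \<open>Local algebras\<close>

definition corner :: "'a \<Rightarrow> 'a set" where "corner e = {e * a * e | a. a \<in> A}"

lemma corner_iff: "e \<in> E \<Longrightarrow> x \<in> corner e \<longleftrightarrow> x \<in> A \<and> e * x = x \<and> x * e = x"
  unfolding corner_def by (auto simp: mult.assoc idems_idem_left idems_idem) (metis mult.assoc)

lemma inverse_semigroup_corner:
  assumes e: "e \<in> E"
  shows "inverse_semigroup (corner e)"
  unfolding inverse_semigroup_on_def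
proof (intro conjI ballI)
  fix x y assume "x \<in> corner e" "y \<in> corner e"
  then show "x * y \<in> corner e"
    unfolding corner_iff[OF e] by (metis mult.assoc mult_closed)
next
  fix x assume x': "x \<in> corner e"
  then have x: "x \<in> A" "e * x = x" "x * e = x" unfolding corner_iff[OF e] by auto
  have "star x = e * star x * e"
  proof (rule inverse_unique[of x])
    show "x * (e * star x * e) * x = x"
      using x by (metis mult.assoc mult_star_mult)
    show "e * star x * e * x * (e * star x * e) = e * star x * e"
      using x by (metis mult.assoc star_mult_star)
  qed (use x e in \<open>auto simp: mult_star_mult star_mult_star\<close>)
  then have "star x \<in> corner e" using x unfolding corner_def by auto
  moreover have "y = star x" if "y \<in> corner e \<and> x * y * x = x \<and> y * x * y = y" for y
    using inverse_unique[of x y "star x"] that x corner_iff[OF e]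
    by (auto simp: mult_star_mult star_mult_star)
  ultimately show "\<exists>!y. y \<in> corner e \<and> x * y * x = x \<and> y * x * y = y"
    using mult_star_mult[OF x(1)] star_mult_star[OF x(1)]
    by (intro ex1I[of _ "star x"] conjI) assumption+
qed (simp add: mult.assoc)

lemma corner_bottom: "e \<in> E \<Longrightarrow> bottom (corner e) = \<zero>"
  by (intro bottom_subset) (auto simp: corner_iff)

lemma idem_atoms_corner:
  assumes e: "e \<in> E"
  shows "idem_atoms (corner e) = {p \<in> P. p * e = p}"
proof -
  have sub: "corner e \<subseteq> A" "\<zero> \<in> corner e"
    using e corner_iff[OF e] by auto
  have id: "f \<in> idems (corner e) \<longleftrightarrow> f \<in> E \<and> f * e = f" for f
  proof
    assume "f \<in> idems (corner e)"
    then show "f \<in> E \<and> f * e = f"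
      unfolding idems_def corner_iff[OF e] by blast
  next
    assume f: "f \<in> E \<and> f * e = f"
    then have "f \<in> corner e" using corner_iff[OF e] idems_commute[OF e, of f] by auto
    then show "f \<in> idems (corner e)" using f unfolding idems_def by blast
  qed
  have "p \<in> idem_atoms (corner e) \<longleftrightarrow> p \<in> P \<and> p * e = p" for p
  proof
    assume "p \<in> idem_atoms (corner e)"
    then have p: "p \<in> E" "p * e = p" "p \<noteq> \<zero>"
      and min: "\<And>f. f \<in> idems (corner e) \<Longrightarrow> f * p \<in> idems (corner e) \<Longrightarrow> f * p = \<zero> \<or> f * p = p"
      unfolding idem_atoms_iff[OF sub] id[symmetric] by (simp_all add: id)
    have "f * p = \<zero> \<or> f * p = p" if f: "f \<in> E" for f
    proof -
      have "f * p \<in> idems (corner e)" "f * p * p = f * p"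
        using f p by (auto simp: id mult.assoc mult_idems_idem idems_idem)
      then show ?thesis using min[of "f * p"] by auto
    qed
    then show "p \<in> P \<and> p * e = p" using p unfolding P_iff by blast
  next
    assume p: "p \<in> P \<and> p * e = p"
    have "f * p = \<zero> \<or> f * p = p" if "f \<in> idems (corner e)" for f
      using that p unfolding id P_iff by blast
    then show "p \<in> idem_atoms (corner e)"
      using p P_nonzero[of p] P_idem[of p] unfolding idem_atoms_iff[OF sub] by (simp add: id)
  qed
  then show ?thesis by blast
qed

end

section \<open>Orbits of atoms\<close>

locale effective_representation = atomistic_inv_semigroup +
  fixes T :: "'t::semigroup_mult set" and \<rho> :: "'t \<Rightarrow> 'a"
  assumes T: "inverse_semigroup T"
    and rep: "representation T A \<rho>"
    and effective: "effective_in A (\<rho> ` T)"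
begin

lemma rho_closed [simp, intro]: "t \<in> T \<Longrightarrow> \<rho> t \<in> A"
  using rep by (auto simp: semigroup_hom_on_def)

lemma rho_mult: "s \<in> T \<Longrightarrow> t \<in> T \<Longrightarrow> \<rho> (s * t) = \<rho> s * \<rho> t"
  using rep by (auto simp: semigroup_hom_on_def)

lemma T_mult [simp, intro]: "s \<in> T \<Longrightarrow> t \<in> T \<Longrightarrow> s * t \<in> T"
  using T by (auto simp: inverse_semigroup_on_def)

lemma T_inverse:
  assumes "t \<in> T" obtains s where "s \<in> T" "t * s * t = t" "s * t * s = s"
  using T assms unfolding inverse_semigroup_on_def by (metis (no_types, lifting))

lemma atom_moved: "p \<in> P \<Longrightarrow> \<exists>t\<in>T. p * \<rho> t \<noteq> \<zero>"
  using effective by (auto simp: effective_in_def)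

definition linked :: "'a \<Rightarrow> 'a \<Rightarrow> bool" where
  "linked p q \<longleftrightarrow> (\<exists>t\<in>T. p * \<rho> t * q \<noteq> \<zero>)"

definition orbit :: "'a \<Rightarrow> 'a set" where
  "orbit p = {q \<in> P. linked p q}"

lemma linked_trans: "p \<in> P \<Longrightarrow> q \<in> P \<Longrightarrow> r \<in> P \<Longrightarrow> linked p q \<Longrightarrow> linked q r \<Longrightarrow> linked p r"
  unfolding linked_def
proof (elim bexE)
  fix s t assume "p \<in> P" "q \<in> P" "r \<in> P" "s \<in> T" "p * \<rho> s * q \<noteq> \<zero>" "t \<in> T" "q * \<rho> t * r \<noteq> \<zero>"
  then have "s * t \<in> T" "p * \<rho> (s * t) * r \<noteq> \<zero>"
    using atom_paths_compose[of p q r "\<rho> s" "\<rho> t"] by (simp_all add: rho_mult)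
  then show "\<exists>t\<in>T. p * \<rho> t * r \<noteq> \<zero>" by blast
qed

text \<open>
  If \<open>t\<close> carries the point \<open>p\<close> to \<open>q\<close>, its inverse \<open>s\<close> carries \<open>q\<close> back to \<open>p\<close>.
\<close>

lemma linked_sym:
  assumes p: "p \<in> P" and q: "q \<in> P" and "linked p q"
  shows "linked q p"
proof -
  obtain t where t: "t \<in> T" and nz: "p * \<rho> t * q \<noteq> \<zero>"
    using assms(3) by (auto simp: linked_def)
  obtain s where s: "s \<in> T" and ts: "t * s * t = t" using T_inverse[OF t] .
  have e: "\<rho> t = \<rho> t * \<rho> s * \<rho> t" using ts t s rho_mult by (metis T_mult)
  have "q * \<rho> s * p \<noteq> \<zero>"
  proof
    assume "q * \<rho> s * p = \<zero>"
    moreover have "p * \<rho> t * q = p * \<rho> t" "p * \<rho> t * q = \<rho> t * q"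
      using atom_mult_absorb atom_mult_absorb_left p q t nz by auto
    then have "p * \<rho> t * q = \<rho> t * (q * \<rho> s * p) * \<rho> t"
      using e by (metis mult.assoc)
    ultimately show False using nz t by simp
  qed
  then show ?thesis using s by (auto simp: linked_def)
qed

text \<open>
  Effectiveness links \<open>p\<close> to some atom, and the way back leads to \<open>p\<close> again.
\<close>

lemma linked_refl:
  assumes p: "p \<in> P"
  shows "linked p p"
proof -
  obtain t where t: "t \<in> T" "p * \<rho> t \<noteq> \<zero>" using atom_moved[OF p] by blast
  then obtain q where "q \<in> P" "p * \<rho> t * q \<noteq> \<zero>"
    using atom_mult_ex_target p by blast
  then have "linked p q" "q \<in> P" using t by (auto simp: linked_def)
  then show ?thesis using linked_trans linked_sym p by blast
qed

lemma orbit_eq: "p \<in> P \<Longrightarrow> q \<in> P \<Longrightarrow> linked p q \<Longrightarrow> orbit p = orbit q"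
  unfolding orbit_def using linked_trans linked_sym by blast

definition orbit_unit :: "'a \<Rightarrow> 'a" where
  "orbit_unit p = nat_sup A (orbit p)"

lemma orbit_unit_idem [simp, intro]: "orbit_unit p \<in> E"
  unfolding orbit_unit_def by (intro idems_bounded) (auto simp: orbit_def)

lemma atom_mult_orbit_unit:
  assumes "p \<in> P" "q \<in> P"
  shows "q * orbit_unit p = (if linked p q then q else \<zero>)"
proof -
  have "p \<in> orbit p" using linked_refl assms by (simp add: orbit_def)
  then have "q * orbit_unit p = (if q \<in> orbit p then q else \<zero>)"
    unfolding orbit_unit_def using assms by (intro atom_mult_nat_sup) (auto simp: orbit_def)
  then show ?thesis using assms by (simp add: orbit_def)
qed

definition orbit_units :: "'a set" where
  "orbit_units = orbit_unit ` P"

lemma orbit_units_idem [simp, intro]: "e \<in> orbit_units \<Longrightarrow> e \<in> E"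
  by (auto simp: orbit_units_def)

text \<open>
  Orbits are invariant: if \<open>q\<close> lies in the orbit and \<open>q * \<rho> t\<close> is non-zero, then its target atom is
  linked to \<open>q\<close>, so it lies below \<open>e\<close>. This makes \<open>t \<mapsto> e * \<rho> t\<close> multiplicative.
\<close>

lemma orbit_unit_mult_rho:
  assumes e: "e \<in> orbit_units" and t: "t \<in> T"
  shows "e * \<rho> t * e = e * \<rho> t"
proof (rule eq_if_atoms_eq)
  fix q assume q: "q \<in> P"
  obtain p where p: "p \<in> P" "e = orbit_unit p" using e by (auto simp: orbit_units_def)
  have eA: "e \<in> A" using e by auto
  have "q * \<rho> t * e = q * \<rho> t" if l: "linked p q" "q * \<rho> t \<noteq> \<zero>"
  proof -
    obtain r where r: "r \<in> P" "q * \<rho> t * r \<noteq> \<zero>"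
      using atom_mult_ex_target q t l by blast
    then have "linked p r" using linked_trans l p q t by (metis linked_def)
    then have "r * e = r" using atom_mult_orbit_unit p r by auto
    moreover have "q * \<rho> t * r = q * \<rho> t" using atom_mult_absorb q t r by auto
    ultimately show ?thesis by (metis mult.assoc)
  qed
  moreover have "q * e = (if linked p q then q else \<zero>)" using atom_mult_orbit_unit p q by auto
  ultimately show "q * (e * \<rho> t * e) = q * (e * \<rho> t)"
    using t eA q by (cases "q * \<rho> t = \<zero>") (auto simp flip: mult.assoc)
qed (use e t in auto)

lemma orbit_units_orthogonal:
  assumes "e \<in> orbit_units" "f \<in> orbit_units" "e \<noteq> f"
  shows "e * f = \<zero>"
proof (rule eq_if_atoms_eq)
  obtain p q where pq: "p \<in> P" "q \<in> P" "e = orbit_unit p" "f = orbit_unit q"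
    using assms by (auto simp: orbit_units_def)
  then have "\<not> linked p q" using orbit_eq assms(3) by (auto simp: orbit_unit_def)
  then have "\<not> (linked p r \<and> linked q r)" if "r \<in> P" for r
    using that pq linked_trans linked_sym by blast
  moreover fix r assume r: "r \<in> P"
  ultimately show "r * (e * f) = r * \<zero>"
    using atom_mult_orbit_unit pq by (simp flip: mult.assoc)
qed (use assms in auto)

section \<open>Existence of the decomposition\<close>

text \<open>
  Every atom \<open>p\<close> lies below the supremum of its own orbit, so \<open>p * \<rho> t\<close> lies below one of the terms.
\<close>

lemma rho_is_sup:
  assumes t: "t \<in> T"
  shows "is_sup A {e * \<rho> t | e. e \<in> orbit_units} (\<rho> t)"
  unfolding is_sup_def
proof (intro conjI ballI impI)
  fix u assume u: "u \<in> A" "\<forall>x\<in>{e * \<rho> t | e. e \<in> orbit_units}. x \<preceq> u"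
  show "\<rho> t \<preceq> u"
  proof (rule le_if_atoms_le)
    fix p assume p: "p \<in> P"
    have "orbit_unit p * \<rho> t \<preceq> u" using u(2) p by (auto simp: orbit_units_def)
    moreover have "p * orbit_unit p = p" using atom_mult_orbit_unit linked_refl p by simp
    then have "p * \<rho> t = p * (orbit_unit p * \<rho> t)" by (simp flip: mult.assoc)
    then have "p * \<rho> t \<preceq> orbit_unit p * \<rho> t" using mult_idem_le p by auto
    ultimately show "p * \<rho> t \<preceq> u" using le_trans by blast
  qed (use t u in auto)
qed (use t in \<open>auto intro: mult_idem_le\<close>)

lemma orbit_rep:
  assumes e: "e \<in> orbit_units"
  shows "representation T (corner e) (\<lambda>t. e * \<rho> t)"
  unfolding semigroup_hom_on_def
proof (intro conjI ballI Pi_I)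
  fix t assume "t \<in> T"
  then show "e * \<rho> t \<in> corner e"
    using orbit_unit_mult_rho[OF e] e by (auto simp: corner_iff idems_idem_left)
next
  fix s t assume "s \<in> T" "t \<in> T"
  then show "e * \<rho> (s * t) = e * \<rho> s * (e * \<rho> t)"
    using orbit_unit_mult_rho[OF e] rho_mult by (metis mult.assoc)
qed

lemma orbit_rep_transitive:
  assumes e: "e \<in> orbit_units"
  shows "transitive_in (corner e) ((\<lambda>t. e * \<rho> t) ` T)"
  unfolding transitive_in_def idem_atoms_corner[OF orbit_units_idem[OF e]]
    corner_bottom[OF orbit_units_idem[OF e]]
proof (intro ballI)
  obtain r where r: "r \<in> P" "e = orbit_unit r" using e by (auto simp: orbit_units_def)
  fix p q assume "p \<in> {p \<in> P. p * e = p}" "q \<in> {p \<in> P. p * e = p}"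
  then have p: "p \<in> P" "p * e = p" and q: "q \<in> P" "q * e = q" by auto
  have "linked r p" "linked r q"
    using atom_mult_orbit_unit[OF r(1)] p q r P_nonzero by metis+
  then have "linked p q" using linked_trans linked_sym p q r by blast
  then obtain t where "t \<in> T" "p * \<rho> t * q \<noteq> \<zero>" by (auto simp: linked_def)
  moreover have "p * (e * \<rho> t) * q = p * \<rho> t * q" using p by (metis mult.assoc)
  ultimately show "\<exists>s\<in>(\<lambda>t. e * \<rho> t) ` T. p * s * q \<noteq> \<zero>" by (metis imageI)
qed

text \<open>
  The image of \<open>T\<close> inherits existence of inverses from \<open>T\<close>, and uniqueness componentwise from \<open>A\<close>.
\<close>

lemma tensor_image_inverse_semigroup:
  assumes rep: "\<And>i. i \<in> I \<Longrightarrow> representation T A (\<psi> i)"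
  shows "inverse_semigroup_on (prod_mult I) (tensor I \<psi> ` T)"
proof -
  let ?m = "prod_mult I" and ?R = "tensor I \<psi> ` T"
  have hom: "?m (tensor I \<psi> s) (tensor I \<psi> t) = tensor I \<psi> (s * t)" if "s \<in> T" "t \<in> T" for s t
    using rep that by (auto simp: prod_mult_def tensor_def semigroup_hom_on_def intro!: restrict_ext)
  have inA: "tensor I \<psi> t i \<in> A" if "t \<in> T" "i \<in> I" for t i
    using rep that by (auto simp: tensor_def semigroup_hom_on_def)
  have ex: "\<exists>y\<in>?R. ?m (?m x y) x = x \<and> ?m (?m y x) y = y" if "x \<in> ?R" for x
  proof -
    obtain t where t: "t \<in> T" "x = tensor I \<psi> t" using \<open>x \<in> ?R\<close> by blast
    obtain s where "s \<in> T" "t * s * t = t" "s * t * s = s" using T_inverse[OF t(1)] .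
    then show ?thesis using t hom by (intro bexI[of _ "tensor I \<psi> s"]) auto
  qed
  have "y = z"
    if "x \<in> ?R" "y \<in> ?R" "z \<in> ?R" "?m (?m x y) x = x" "?m (?m y x) y = y"
      "?m (?m x z) x = x" "?m (?m z x) z = z" for x y z
  proof
    fix i
    show "y i = z i"
    proof (cases "i \<in> I")
      case True
      have mi: "?m v w i = v i * w i" for v w using True by (simp add: prod_mult_def)
      have eqs: "x i * y i * x i = x i" "y i * x i * y i = y i"
        "x i * z i * x i = x i" "z i * x i * z i = z i"
        using that(4-7) by (metis mi)+
      show ?thesis
        by (rule inverse_unique[of "x i"]) (use that(1-3) True inA eqs in auto)
    next
      case False
      then show ?thesis using that(2,3) by (auto simp: tensor_def)
    qed
  qed
  then have "\<exists>!y. y \<in> ?R \<and> ?m (?m x y) x = x \<and> ?m (?m y x) y = y" if "x \<in> ?R" for x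
    using that ex by (metis (no_types, lifting))
  moreover have "?m (?m x y) z = ?m x (?m y z)" for x y z
    by (auto simp: prod_mult_def mult.assoc)
  moreover have "?m x y \<in> ?R" if "x \<in> ?R" "y \<in> ?R" for x y
  proof -
    obtain s t where "s \<in> T" "t \<in> T" "x = tensor I \<psi> s" "y = tensor I \<psi> t"
      using \<open>x \<in> ?R\<close> \<open>y \<in> ?R\<close> by blast
    then show ?thesis using hom by simp
  qed
  ultimately show ?thesis unfolding inverse_semigroup_on_def by (intro conjI ballI) assumption+
qed

text \<open>
  The suprema serve as names of the orbits: they are non-zero, and distinct orbits have orthogonal
  ones. This makes the index set a subset of \<open>A\<close>.
\<close>

lemma orbit_decomposition:
  "transitive_decomposition A T \<rho> orbit_units corner (\<lambda>e t. e * \<rho> t)"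
proof -
  let ?\<psi> = "\<lambda>e t. e * \<rho> t"
  let ?I = orbit_units
  have sup: "nat_sup A {e * \<rho> t | e. e \<in> ?I} = \<rho> t" if "t \<in> T" for t
    using rho_is_sup[OF that] by (rule is_sup_unique)
  have img: "tensor ?I ?\<psi> t ` ?I = {e * \<rho> t | e. e \<in> ?I}" for t
    by (auto simp: tensor_def)
  have rep': "representation T A (?\<psi> e)" if "e \<in> ?I" for e
    using orbit_rep[OF that] that by (auto simp: semigroup_hom_on_def)
  have hom: "prod_mult ?I (tensor ?I ?\<psi> s) (tensor ?I ?\<psi> t) = tensor ?I ?\<psi> (s * t)"
    if "s \<in> T" "t \<in> T" for s t
    using rep' that by (auto simp: prod_mult_def tensor_def semigroup_hom_on_def intro!: restrict_ext)
  have local: "local_algebra A (corner e)" if "e \<in> ?I" for e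
    using that unfolding local_algebra_def corner_def by blast
  have nz: "corner e \<noteq> {\<zero>}" if e: "e \<in> ?I" for e
  proof -
    obtain p where p: "p \<in> P" "e = orbit_unit p" using e by (auto simp: orbit_units_def)
    then have "p * e = p" using atom_mult_orbit_unit linked_refl by simp
    then have "e \<noteq> \<zero>" using p(1) P_nonzero by force
    moreover have "e \<in> corner e" using corner_iff[of e e] e by (simp add: idems_idem)
    ultimately show ?thesis by blast
  qed
  have schein: "schein_sum A T ?I corner ?\<psi>"
    unfolding schein_sum_def schein_sum_set_def
  proof (intro conjI ballI)
    fix e assume e: "e \<in> ?I"
    show "corner e \<subseteq> A" using e by (auto simp: corner_iff)
    show "inverse_semigroup (corner e)" using e by (intro inverse_semigroup_corner) auto
    show "representation T (corner e) (?\<psi> e)" by (rule orbit_rep[OF e])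
  next
    have "tensor ?I ?\<psi> t \<in> PiE ?I corner" if "t \<in> T" for t
      unfolding tensor_def
    proof (rule restrict_PiE_iff[THEN iffD2], rule ballI)
      fix e assume "e \<in> ?I"
      then have "(\<lambda>t. e * \<rho> t) \<in> T \<rightarrow> corner e"
        using orbit_rep unfolding semigroup_hom_on_def by blast
      then show "e * \<rho> t \<in> corner e" using that by (rule funcset_mem)
    qed
    moreover have "bounded_above A (tensor ?I ?\<psi> t ` ?I)" if "t \<in> T" for t
      unfolding img bounded_above_def using rho_is_sup[OF that] by (auto simp: is_sup_def)
    ultimately show "tensor ?I ?\<psi> ` T \<subseteq> bounded_prod A ?I corner"
      by (auto simp: bounded_prod_def)
    show "inverse_semigroup_on (prod_mult ?I) (tensor ?I ?\<psi> ` T)"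
      by (rule tensor_image_inverse_semigroup[OF rep'])
    show "semigroup_hom_on (prod_mult ?I) (tensor ?I ?\<psi> ` T) (*) A (omega A ?I)"
      unfolding semigroup_hom_on_def omega_def
      by (auto simp: hom img sup simp flip: rho_mult)
  qed
  have "orthogonal_sum A T ?I ?\<psi>"
    unfolding orthogonal_sum_def
  proof (intro ballI impI)
    fix e f assume ef: "e \<in> ?I" "f \<in> ?I" "e \<noteq> f"
    obtain p where "p \<in> P" using ef by (auto simp: orbit_units_def)
    then have "T \<noteq> {}" using atom_moved by blast
    have "e * \<rho> s * (f * \<rho> t) = \<zero>" if "s \<in> T" "t \<in> T" for s t
    proof -
      have "e * \<rho> s * (f * \<rho> t) = e * \<rho> s * (e * f) * \<rho> t"
        using orbit_unit_mult_rho[OF ef(1) that(1)] by (metis mult.assoc)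
      then show ?thesis using orbit_units_orthogonal ef that by simp
    qed
    then have zero: "(\<lambda>(s, t). e * \<rho> s * (f * \<rho> t)) ` (T \<times> T) = (\<lambda>_. \<zero>) ` (T \<times> T)"
      by (intro image_cong) auto
    have "{x * y | x y. x \<in> ?\<psi> e ` T \<and> y \<in> ?\<psi> f ` T} =
        (\<lambda>(s, t). e * \<rho> s * (f * \<rho> t)) ` (T \<times> T)"
      by auto
    also have "\<dots> = {\<zero>}" using \<open>T \<noteq> {}\<close> unfolding zero by auto
    finally show "{x * y | x y. x \<in> ?\<psi> e ` T \<and> y \<in> ?\<psi> f ` T} = {\<zero>}" .
  qed
  then show ?thesis
    unfolding transitive_decomposition_def
    using local nz orbit_rep orbit_rep_transitive schein sup by auto
qed

section \<open>Uniqueness of the decomposition\<close>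

text \<open>
  Any decomposition is obtained by restricting \<open>\<rho>\<close> to orthogonal idempotents which partition the
  atoms into the orbits. The last clause identifies an \<open>e i\<close> from a single atom below it.
\<close>

lemma decomposition_units:
  assumes dec: "transitive_decomposition A T \<rho> I B \<psi>"
  obtains e where "\<And>i. i \<in> I \<Longrightarrow> e i \<in> E \<and> e i \<noteq> \<zero> \<and> B i = corner (e i)"
    and "\<And>i t. i \<in> I \<Longrightarrow> t \<in> T \<Longrightarrow> \<psi> i t = e i * \<rho> t"
    and "\<And>i j. i \<in> I \<Longrightarrow> j \<in> I \<Longrightarrow> i \<noteq> j \<Longrightarrow> e i * e j = \<zero>"
    and "\<And>p. p \<in> P \<Longrightarrow> \<exists>i\<in>I. p * e i = p"
    and "\<And>i p q. i \<in> I \<Longrightarrow> p \<in> P \<Longrightarrow> q \<in> P \<Longrightarrow> p * e i = p \<Longrightarrow> q * e i = q \<longleftrightarrow> linked p q"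
proof -
  have "\<forall>i\<in>I. \<exists>e. e \<in> E \<and> B i = corner e"
    using dec unfolding transitive_decomposition_def local_algebra_def corner_def by blast
  then obtain e where e: "\<And>i. i \<in> I \<Longrightarrow> e i \<in> E \<and> B i = corner (e i)" by metis
  have rep: "representation T (B i) (\<psi> i)" "transitive_in (B i) (\<psi> i ` T)" "B i \<noteq> {\<zero>}"
    if "i \<in> I" for i
    using dec that by (auto simp: transitive_decomposition_def)
  have val: "\<psi> i t \<in> A \<and> e i * \<psi> i t = \<psi> i t \<and> \<psi> i t * e i = \<psi> i t" if "i \<in> I" "t \<in> T" for i t
  proof -
    have "\<psi> i t \<in> B i" using rep(1)[OF that(1)] that(2) by (auto simp: semigroup_hom_on_def)
    then show ?thesis using e[OF that(1)] corner_iff by auto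
  qed
  have nz: "e i \<noteq> \<zero>" if i: "i \<in> I" for i
  proof
    assume "e i = \<zero>"
    then have "B i \<subseteq> {\<zero>}" "\<zero> \<in> B i" using e[OF i] by (auto simp: corner_iff)
    then show False using rep(3)[OF i] by blast
  qed
  have trans: "\<exists>t\<in>T. p * \<psi> i t * q \<noteq> \<zero>"
    if "i \<in> I" "p \<in> P" "q \<in> P" "p * e i = p" "q * e i = q" for i p q
    using rep(2)[OF that(1)] e[OF that(1)] that(2-)
    by (auto simp: transitive_in_def idem_atoms_corner corner_bottom)
  have sup: "\<rho> t = nat_sup A {\<psi> i t | i. i \<in> I}" if "t \<in> T" for t
    using dec that by (auto simp: transitive_decomposition_def)
  have bdd: "bounded_above A {\<psi> i t | i. i \<in> I}" if "t \<in> T" for t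
  proof -
    have "tensor I \<psi> t \<in> bounded_prod A I B"
      using dec that by (auto simp: transitive_decomposition_def schein_sum_def schein_sum_set_def)
    moreover have "tensor I \<psi> t ` I = {\<psi> i t | i. i \<in> I}" by (auto simp: tensor_def)
    ultimately show ?thesis by (auto simp: bounded_prod_def)
  qed
  have orth: "\<psi> i s * \<psi> j t = \<zero>" if "i \<in> I" "j \<in> I" "i \<noteq> j" "s \<in> T" "t \<in> T" for i j s t
    using dec that unfolding transitive_decomposition_def orthogonal_sum_def by blast
  \<comment> \<open>A common atom \<open>p\<close> would be returned to itself by \<open>\<psi> i s\<close> and by \<open>\<psi> j t\<close>, hence by their product.\<close>
  have ee: "e i * e j = \<zero>" if ij: "i \<in> I" "j \<in> I" "i \<noteq> j" for i j
  proof (rule ccontr)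
    assume "e i * e j \<noteq> \<zero>"
    then obtain p where p: "p \<in> P" "p * (e i * e j) \<noteq> \<zero>"
      using ex_atom_mult_nonzero[of "e i * e j"] e ij by auto
    have pi: "p * e i = p"
      using P_cases[of p "e i"] p e ij by (metis mult.assoc zero_mult idems_closed)
    then have pj: "p * e j = p"
      using P_cases[of p "e j"] p e ij by (metis mult.assoc)
    obtain s t where st: "s \<in> T" "p * \<psi> i s * p \<noteq> \<zero>" "t \<in> T" "p * \<psi> j t * p \<noteq> \<zero>"
      using trans ij p(1) pi pj by metis
    then have "p * (\<psi> i s * \<psi> j t) * p \<noteq> \<zero>"
      using atom_paths_compose[of p p p] p val ij by blast
    then show False using orth[OF ij st(1,3)] p by simp
  qed
  \<comment> \<open>Multiplication by \<open>e i\<close> kills all terms of the supremum \<open>\<rho> t\<close> other than \<open>\<psi> i t\<close>.\<close>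
  have comp: "\<psi> i t = e i * \<rho> t" if i: "i \<in> I" and t: "t \<in> T" for i t
  proof -
    have "e i * \<psi> j t = \<zero>" if "j \<in> I" "j \<noteq> i" for j
    proof -
      have "e i * \<psi> j t = e i * e j * \<psi> j t" using val[OF that(1) t] by (metis mult.assoc)
      then show ?thesis using ee[of i j] that i val[OF that(1) t] by simp
    qed
    then have "e i * nat_sup A {\<psi> i t | i. i \<in> I} = e i * \<psi> i t"
      using e[OF i] val t i by (intro mult_nat_sup bdd) auto
    then show ?thesis using sup[OF t] val i t by simp
  qed
  \<comment> \<open>An atom below no \<open>e i\<close> would annihilate all terms, hence \<open>\<rho>\<close>, against effectiveness.\<close>
  have cover: "\<exists>i\<in>I. p * e i = p" if p: "p \<in> P" for p
  proof (rule ccontr)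
    assume none: "\<not> ?thesis"
    obtain t where t: "t \<in> T" "p * \<rho> t \<noteq> \<zero>" using atom_moved[OF p] by blast
    have "p * \<psi> i t = \<zero>" if i: "i \<in> I" for i
    proof -
      have "p * e i = \<zero>" using P_cases[OF p, of "e i"] e none i by blast
      then show ?thesis using val[OF i t(1)] by (metis mult.assoc zero_mult)
    qed
    then have 0: "{p * y | y. y \<in> {\<psi> i t | i. i \<in> I}} \<subseteq> {\<zero>}" by auto
    have "is_sup A X \<zero>" if "X \<subseteq> {\<zero>}" for X
      using that by (auto simp: is_sup_def intro: zero_le)
    then have "nat_sup A {p * y | y. y \<in> {\<psi> i t | i. i \<in> I}} = \<zero>"
      using is_sup_unique 0 by blast
    moreover have "{\<psi> i t | i. i \<in> I} \<subseteq> A" using val t by auto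
    ultimately have "p * \<rho> t = \<zero>"
      using distributive bdd[OF t(1)] P_closed[OF p] sup[OF t(1)]
      unfolding completely_distributive_def by simp
    then show False using t by simp
  qed
  have orbit: "q * e i = q \<longleftrightarrow> linked p q"
    if i: "i \<in> I" and p: "p \<in> P" and q: "q \<in> P" and pe: "p * e i = p" for i p q
  proof -
    have pt: "p * \<psi> i t = p * \<rho> t" if "t \<in> T" for t
      using comp[OF i that] pe by (metis mult.assoc)
    show ?thesis
    proof
      assume "q * e i = q"
      then show "linked p q" using trans[OF i p q pe] pt by (auto simp: linked_def)
    next
      assume "linked p q"
      then obtain t where t: "t \<in> T" "p * \<psi> i t * q \<noteq> \<zero>" using pt by (auto simp: linked_def)
      have eq: "e i * q = q * e i" using idems_commute e i q by auto
      have "p * \<psi> i t * (e i * q) \<noteq> \<zero>"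
        using t(2) val[OF i t(1)] by (metis mult.assoc)
      then have "q * e i \<noteq> \<zero>" using eq p val[OF i t(1)] by auto
      then show "q * e i = q" using P_cases[OF q, of "e i"] e i by blast
    qed
  qed
  show thesis
    by (rule that[of e]) (use e nz in blast, (fact comp ee cover orbit)+)
qed

text \<open>
  Two decompositions have the same set of identities, and each indexes this set injectively since
  the identities are non-zero and orthogonal; so the index sets are matched through it.
\<close>

lemma decomposition_unique:
  assumes dec: "transitive_decomposition A T \<rho> I B \<psi>" "transitive_decomposition A T \<rho> J C \<chi>"
  shows "\<exists>\<pi>. bij_betw \<pi> I J \<and> (\<forall>i\<in>I. B i = C (\<pi> i) \<and> (\<forall>t\<in>T. \<psi> i t = \<chi> (\<pi> i) t))"
proof -
  obtain e where e: "\<And>i. i \<in> I \<Longrightarrow> e i \<in> E \<and> e i \<noteq> \<zero> \<and> B i = corner (e i)"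
    "\<And>i t. i \<in> I \<Longrightarrow> t \<in> T \<Longrightarrow> \<psi> i t = e i * \<rho> t"
    "\<And>i j. i \<in> I \<Longrightarrow> j \<in> I \<Longrightarrow> i \<noteq> j \<Longrightarrow> e i * e j = \<zero>"
    "\<And>p. p \<in> P \<Longrightarrow> \<exists>i\<in>I. p * e i = p"
    "\<And>i p q. i \<in> I \<Longrightarrow> p \<in> P \<Longrightarrow> q \<in> P \<Longrightarrow> p * e i = p \<Longrightarrow> q * e i = q \<longleftrightarrow> linked p q"
    using decomposition_units[OF dec(1)] by blast
  obtain f where f: "\<And>j. j \<in> J \<Longrightarrow> f j \<in> E \<and> f j \<noteq> \<zero> \<and> C j = corner (f j)"
    "\<And>j t. j \<in> J \<Longrightarrow> t \<in> T \<Longrightarrow> \<chi> j t = f j * \<rho> t"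
    "\<And>i j. i \<in> J \<Longrightarrow> j \<in> J \<Longrightarrow> i \<noteq> j \<Longrightarrow> f i * f j = \<zero>"
    "\<And>p. p \<in> P \<Longrightarrow> \<exists>j\<in>J. p * f j = p"
    "\<And>j p q. j \<in> J \<Longrightarrow> p \<in> P \<Longrightarrow> q \<in> P \<Longrightarrow> p * f j = p \<Longrightarrow> q * f j = q \<longleftrightarrow> linked p q"
    using decomposition_units[OF dec(2)] by blast
  have below: "\<exists>p\<in>P. p * a = p" if "a \<in> E" "a \<noteq> \<zero>" for a
    using ex_atom_mult_nonzero[of a] P_cases[of _ a] that by auto
  have inj: "inj_on e I" "inj_on f J"
    by (rule inj_onI, metis e(1,3) idems_idem, rule inj_onI, metis f(1,3) idems_idem)
  have "e i \<in> f ` J" if i: "i \<in> I" for i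
  proof -
    obtain p where p: "p \<in> P" "p * e i = p" using below e(1) i by blast
    obtain j where j: "j \<in> J" "p * f j = p" using f(4) p by blast
    have "e i = f j"
    proof (rule idems_eq_if_atoms_eq)
      show "q * e i = q \<longleftrightarrow> q * f j = q" if "q \<in> P" for q
        using e(5)[OF i p(1) that] f(5)[OF j(1) p(1) that] i j(2) p by blast
    qed (use e(1) f(1) i j in blast)+
    then show ?thesis using j by blast
  qed
  moreover have "f j \<in> e ` I" if j: "j \<in> J" for j
  proof -
    obtain p where p: "p \<in> P" "p * f j = p" using below f(1) j by blast
    obtain i where i: "i \<in> I" "p * e i = p" using e(4) p by blast
    have "f j = e i"
    proof (rule idems_eq_if_atoms_eq)
      show "q * f j = q \<longleftrightarrow> q * e i = q" if "q \<in> P" for q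
        using e(5)[OF i(1) p(1) that] f(5)[OF j p(1) that] i(2) j p by blast
    qed (use e(1) f(1) i j in blast)+
    then show ?thesis using i by blast
  qed
  ultimately have img: "e ` I = f ` J" by blast
  let ?\<pi> = "inv_into J f \<circ> e"
  have "bij_betw e I (f ` J)" using inj img by (simp add: bij_betw_def)
  moreover have "bij_betw (inv_into J f) (f ` J) J"
    using inj by (intro bij_betw_inv_into inj_on_imp_bij_betw)
  ultimately have "bij_betw ?\<pi> I J" by (rule bij_betw_trans)
  moreover have "?\<pi> i \<in> J \<and> f (?\<pi> i) = e i" if "i \<in> I" for i
    using img that by (metis comp_apply f_inv_into_f imageI inv_into_into)
  ultimately show ?thesis using e(1,2) f(1,2) by metis
qed

end

section \<open>The decomposition theorem\<close>

theorem theorem8p2: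
  fixes A :: "'a::semigroup_mult set" and T :: "'t::semigroup_mult set" and \<rho> :: "'t \<Rightarrow> 'a"
  assumes "inverse_meet_semigroup A" and "unital A" and "nat_complete A"
    and "completely_distributive A" and "atomistic A"
    and "inverse_semigroup T"
    and "representation T A \<rho>" and "effective_in A (\<rho> ` T)"
  shows "(\<exists>(I :: 'a set) (B :: 'a \<Rightarrow> 'a set) (\<psi> :: 'a \<Rightarrow> 't \<Rightarrow> 'a).
            transitive_decomposition A T \<rho> I B \<psi>) \<and>
         (\<forall>(I :: 'i set) (B :: 'i \<Rightarrow> 'a set) (\<psi> :: 'i \<Rightarrow> 't \<Rightarrow> 'a)
           (J :: 'j set) (C :: 'j \<Rightarrow> 'a set) (\<chi> :: 'j \<Rightarrow> 't \<Rightarrow> 'a).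
            transitive_decomposition A T \<rho> I B \<psi> \<longrightarrow> transitive_decomposition A T \<rho> J C \<chi> \<longrightarrow>
            (\<exists>\<pi>. bij_betw \<pi> I J \<and> (\<forall>i\<in>I. B i = C (\<pi> i) \<and> (\<forall>t\<in>T. \<psi> i t = \<chi> (\<pi> i) t))))"
proof -
  interpret effective_representation A T \<rho>
    using assms by unfold_locales (auto simp: inverse_meet_semigroup_def)
  show ?thesis
    using orbit_decomposition decomposition_unique by blast
qed

end
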